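(* For any decoding scheme whose worst-layer failure rate $\varepsilon=\max_{0\le k\le\ell}\varepsilon_k$ satisfies $\varepsilon\in(0,1/2)$, the Master lower bound $$\mathbb{E}_{\mathbf v}\langle f\rangle\;\ge\;\frac{\lambda_{\max}(1-2\bar\varepsilon)+2d\bar\eta}{1-\bar\varepsilon}$$ is at least as tight as Jordan's bound $$\mathbb{E}_{\mathbf v}\langle f\rangle\;\ge\;\frac{\mathbf w^{T}\left[A-2\varepsilon(q-1)(m+1)I\right]\mathbf w}{\sum_{k=0}^{\ell}w_k^2(1-\varepsilon_k)}\;\ge\;\lambda_{\max}-2\varepsilon(q-1)(m+1),$$ and it is strictly tighter unless $\varepsilon_k$ is identical for all $k$ and $\mu=1/2$. Relative to Jordan's relaxed form (the right-most expression of the chain), the improvement decomposes into two components: (i) the structural replacement of the operator-norm penalty $2\varepsilon(q-1)(m+1)$ by the Rayleigh-quotient penalty $2\bar\varepsilon\lambda_{\max}$, which simultaneously replaces $\varepsilon$ by $\bar\varepsilon\le\varepsilon$ and rescales $(q-1)(m+1)$ to $\lambda_{\max}$; and (ii) retaining the exact denominator $1-\bar\varepsilon$, which Jordan's relaxed form relaxes to $1$. Relative to Jordan's tight form (the middle expression of the chain), only (i) remains, since (ii) is common to both.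
   Context: Setting: Decoded Quantum Interferometry (DQI) for MAX-LINSAT over a finite field $\mathbb{F}_q$ with $m$ constraints: given $B\in\mathbb{F}_q^{m\times n}$ with rows $\mathbf b_i$ and a target $\mathbf v\in\mathbb{F}_q^m$, maximize the number $s(\mathbf x)$ of indices $i$ with $\mathbf b_i\cdot\mathbf x=v_i$. The objective $f$ is related to $s$ by $s=m/q+(q-1)f/(2q)$; $\langle f\rangle$ is its expectation in the DQI state of polynomial degree $\ell\le m$, and $\mathbb{E}_{\mathbf v}$ is the average over uniformly random $\mathbf v\in\mathbb{F}_q^m$. Put $\mu=\ell/m$. DQI matrix: $A=A_q^{(m,\ell,d)}$ is the real symmetric tridiagonal $(\ell+1)\times(\ell+1)$ matrix, indexed by $k=0,\dots,\ell$, with diagonal entries $kd$ and off-diagonal entries (positions $(k,k+1)$ and $(k+1,k)$) $\sqrt{(q-1)(k+1)(m-k)}$; $d$ is the diagonal offset parameter. $\lambda_{\max}$ is its largest eigenvalue and $\mathbf w=(w_0,\dots,w_\ell)^T$ its normalized leading eigenvector, which has all $w_k>0$. A decoding scheme uses a classical decoder that fails on Hamming layer $k$ (errors of weight $k$) with rate $\varepsilon_k$. The weighted failure rate is $\bar\varepsilon=\sum_{k=0}^{\ell}\varepsilon_kw_k^2$ and the weighted failure moment is $\bar\eta=\sum_{k=0}^{\ell}k\varepsilon_kw_k^2$; thus $\sum_k w_k^2(1-\varepsilon_k)=1-\bar\varepsilon$. "Jordan's bound" is the earlier bound of Jordan et al. (originally proved for $\mathbb{F}_2$, where the penalty is $2\varepsilon(m+1)$);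 its middle expression is called the tight form and its right-most expression the relaxed form. A lower bound is at least as tight as (strictly tighter than) another if its value is at least as large (strictly larger).
   Formalization: The second inequality of Jordan's chain fails when 2ε(q-1)(m+1) > λ_max, so it is stated as equivalent to 2ε(q-1)(m+1) ≤ λ_max; Master versus the relaxed form can fail for d<0 and is stated directly only for d ≥ 0. Master versus the tight form holds for all d. *)

theory Defs
  imports
    "Jordan_Normal_Form.Spectral_Radius"
    "HOL-Number_Theory.Prime_Powers"
begin

definition dqi_matrix :: "nat \<Rightarrow> nat \<Rightarrow> nat \<Rightarrow> real \<Rightarrow> real mat" where
  "dqi_matrix q m l d = mat (l + 1) (l + 1) (\<lambda>(i, j).
     if i = j then real i * d
     else if j = i + 1 then sqrt ((real q - 1) * (real i + 1) * (real m - real i))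
     else if i = j + 1 then sqrt ((real q - 1) * (real j + 1) * (real m - real j))
     else 0)"

text \<open>The maximum is over the real eigenvalues: a finite set, and nonempty for symmetric matrices.\<close>

definition lambda_max :: "real mat \<Rightarrow> real" where
  "lambda_max A = Max (spectrum A)"

text \<open>The DQI matrix is an irreducible tridiagonal matrix with positive off-diagonal entries, so
  the positivity condition only selects one of the two unit vectors in the (one-dimensional)
  leading eigenspace.\<close>

definition leading_eigenvector :: "real mat \<Rightarrow> real vec \<Rightarrow> bool" where
  "leading_eigenvector A w \<longleftrightarrow>
     eigenvector A w (lambda_max A) \<and> w \<bullet> w = 1 \<and> (\<forall>k < dim_vec w. w $ k > 0)"

text \<open>A decoding scheme enters through its failure rates: \<open>eps k\<close> is the rate at which the
  decoder fails on errors of Hamming weight \<open>k\<close>.\<close>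

definition worst_failure :: "nat \<Rightarrow> (nat \<Rightarrow> real) \<Rightarrow> real" where
  "worst_failure l eps = Max (eps ` {0..l})"

definition weighted_failure :: "nat \<Rightarrow> real vec \<Rightarrow> (nat \<Rightarrow> real) \<Rightarrow> real" where
  "weighted_failure l w eps = (\<Sum>k = 0..l. eps k * (w $ k)\<^sup>2)"

definition weighted_failure_moment :: "nat \<Rightarrow> real vec \<Rightarrow> (nat \<Rightarrow> real) \<Rightarrow> real" where
  "weighted_failure_moment l w eps = (\<Sum>k = 0..l. real k * eps k * (w $ k)\<^sup>2)"

definition master_bound :: "nat \<Rightarrow> nat \<Rightarrow> nat \<Rightarrow> real \<Rightarrow> real vec \<Rightarrow> (nat \<Rightarrow> real) \<Rightarrow> real" where
  "master_bound q m l d w eps =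
     (lambda_max (dqi_matrix q m l d) * (1 - 2 * weighted_failure l w eps)
        + 2 * d * weighted_failure_moment l w eps)
     / (1 - weighted_failure l w eps)"

definition jordan_penalty :: "nat \<Rightarrow> nat \<Rightarrow> nat \<Rightarrow> (nat \<Rightarrow> real) \<Rightarrow> real" where
  "jordan_penalty q m l eps = 2 * worst_failure l eps * (real q - 1) * (real m + 1)"

definition jordan_tight :: "nat \<Rightarrow> nat \<Rightarrow> nat \<Rightarrow> real \<Rightarrow> real vec \<Rightarrow> (nat \<Rightarrow> real) \<Rightarrow> real" where
  "jordan_tight q m l d w eps =
     (w \<bullet> ((dqi_matrix q m l d - jordan_penalty q m l eps \<cdot>\<^sub>m 1\<^sub>m (l + 1)) *\<^sub>v w))
     / (\<Sum>k = 0..l. (w $ k)\<^sup>2 * (1 - eps k))"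

definition jordan_relaxed :: "nat \<Rightarrow> nat \<Rightarrow> nat \<Rightarrow> real \<Rightarrow> (nat \<Rightarrow> real) \<Rightarrow> real" where
  "jordan_relaxed q m l d eps = lambda_max (dqi_matrix q m l d) - jordan_penalty q m l eps"

definition rayleigh_penalty :: "nat \<Rightarrow> nat \<Rightarrow> nat \<Rightarrow> real \<Rightarrow> real vec \<Rightarrow> (nat \<Rightarrow> real) \<Rightarrow> real" where
  "rayleigh_penalty q m l d w eps =
     2 * weighted_failure l w eps * lambda_max (dqi_matrix q m l d)"

text \<open>The two components of the improvement. The structural gain is the effect of exchanging
  the penalty at fixed denominator; the offset term \<open>2 * d * weighted_failure_moment\<close>
  comes with the Rayleigh quotient and vanishes for \<open>d = 0\<close>. The denominator gain is the
  effect of exchanging the denominator at fixed (operator-norm) penalty.\<close>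

definition structural_gain :: "nat \<Rightarrow> nat \<Rightarrow> nat \<Rightarrow> real \<Rightarrow> real vec \<Rightarrow> (nat \<Rightarrow> real) \<Rightarrow> real" where
  "structural_gain q m l d w eps =
     (jordan_penalty q m l eps - rayleigh_penalty q m l d w eps
        + 2 * d * weighted_failure_moment l w eps)
     / (1 - weighted_failure l w eps)"

definition denominator_gain :: "nat \<Rightarrow> nat \<Rightarrow> nat \<Rightarrow> real \<Rightarrow> real vec \<Rightarrow> (nat \<Rightarrow> real) \<Rightarrow> real" where
  "denominator_gain q m l d w eps =
     (lambda_max (dqi_matrix q m l d) - jordan_penalty q m l eps)
       / (1 - weighted_failure l w eps)
     - (lambda_max (dqi_matrix q m l d) - jordan_penalty q m l eps) / 1"

end

theory Submission
  imports Defs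
begin

text \<open>Up to the common positive denominator, the master bound exceeds the tight form of Jordan's
  bound by \<open>2\<epsilon>(q - 1)(m + 1) - 2 (\<Sum>k. \<epsilon>\<^sub>k w\<^sub>k\<^sup>2 (\<lambda> - k d))\<close>.
  The eigenvalue equation says that \<open>(\<lambda> - k d) w\<^sub>k\<close> is the \<open>k\<close>-th entry of the
  off-diagonal part \<open>A\<^sub>0\<close> of the matrix applied to \<open>w\<close>, which is nonnegative, so every
  \<open>\<epsilon>\<^sub>k\<close> may be replaced by the worst failure rate \<open>\<epsilon>\<close>. It remains to bound the quadratic form
  of \<open>A\<^sub>0\<close> at the unit vector \<open>w\<close>. The entries of \<open>A\<^sub>0\<close> are at most \<open>(q - 1)(m + 1) / 2\<close> by
  AM-GM, and twice the sum of the \<open>w\<^sub>k w\<^sub>k\<^sub>+\<^sub>1\<close> is at most \<open>2 - w\<^sub>0\<^sup>2\<close>, so the form is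
  strictly below \<open>(q - 1)(m + 1)\<close>; this makes the comparison strict in all cases. If
  \<open>\<lambda>\<close> is below Jordan's penalty, the relaxed form is negative, whereas for \<open>d \<ge> 0\<close>
  the master bound is nonnegative.\<close>

section \<open>Off-diagonal entries and rows of the DQI matrix\<close>

definition dqi_coupling :: "nat \<Rightarrow> nat \<Rightarrow> nat \<Rightarrow> real" where
  "dqi_coupling q m k = sqrt ((real q - 1) * (real k + 1) * (real m - real k))"

lemma dqi_coupling_nonneg:
  assumes "1 \<le> q" and "k \<le> m"
  shows "0 \<le> dqi_coupling q m k"
  using assms by (simp add: dqi_coupling_def)

lemma dqi_coupling_le:
  assumes "2 \<le> q" and "k \<le> m"
  shows "2 * dqi_coupling q m k \<le> (real q - 1) * (real m + 1)"
proof -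
  have "dqi_coupling q m k \<le> ((real q - 1) * (real k + 1) + (real m - real k)) / 2"
    unfolding dqi_coupling_def using assms by (intro arith_geo_mean_sqrt) auto
  \<comment> \<open>Raising the second AM-GM factor \<open>m - k\<close> to
    \<open>(q - 1) * (m - k)\<close> makes \<open>k\<close> cancel from the sum.\<close>
  moreover have "1 * (real m - real k) \<le> (real q - 1) * (real m - real k)"
    using assms by (intro mult_right_mono) auto
  ultimately show ?thesis
    by (simp add: algebra_simps)
qed

lemma dqi_matrix_mult_vec:
  assumes w: "w \<in> carrier_vec (l + 1)" and k: "k \<le> l"
  shows "(dqi_matrix q m l d *\<^sub>v w) $ k =
    real k * d * w $ k
    + (if k = 0 then 0 else dqi_coupling q m (k - 1) * w $ (k - 1))
    + (if k = l then 0 else dqi_coupling q m k * w $ (k + 1))"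
proof -
  have "(dqi_matrix q m l d *\<^sub>v w) $ k = (\<Sum>j<l + 1. dqi_matrix q m l d $$ (k, j) * w $ j)"
    using w k by (simp add: dqi_matrix_def scalar_prod_def atLeast0LessThan)
  \<comment> \<open>At \<open>k = 0\<close> truncated subtraction gives \<open>k - 1 = 0\<close>,
    hence the inner test. At \<open>k = l\<close> the index \<open>k + 1\<close> falls outside the
    range of summation.\<close>
  also have "\<dots> = (\<Sum>j<l + 1. (if j = k then real k * d * w $ j else 0)
      + (if j = k - 1 then (if k = 0 then 0 else dqi_coupling q m j * w $ j) else 0)
      + (if j = k + 1 then dqi_coupling q m k * w $ j else 0))"
    using k by (intro sum.cong) (auto simp: dqi_matrix_def dqi_coupling_def)
  also have "\<dots> = real k * d * w $ k
      + (if k = 0 then 0 else dqi_coupling q m (k - 1) * w $ (k - 1))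
      + (if k = l then 0 else dqi_coupling q m k * w $ (k + 1))"
    using k by (cases k) (auto simp: sum.distrib)
  finally show ?thesis .
qed

lemma unit_vec_sum_squares:
  fixes w :: "real vec"
  assumes "w \<in> carrier_vec (l + 1)" and "w \<bullet> w = 1"
  shows "(\<Sum>k\<le>l. (w $ k)\<^sup>2) = 1"
  using assms
  by (simp add: scalar_prod_def power2_eq_square atLeast0LessThan lessThan_Suc_atMost
      del: sum.lessThan_Suc sum.atMost_Suc)

section \<open>Quadratic form of the off-diagonal part\<close>

lemma sum_pred_shift:
  fixes g :: "nat \<Rightarrow> real"
  shows "(\<Sum>k\<le>l. if k = 0 then 0 else g (k - 1)) = (\<Sum>k<l. g k)"
  by (induction l) auto

text \<open>The left-hand side is the quadratic form of the off-diagonal part of the matrix.\<close>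

lemma coupling_form_less:
  fixes w :: "nat \<Rightarrow> real"
  assumes q: "2 \<le> q" and l: "l \<le> m"
    and pos: "\<And>k. k \<le> l \<Longrightarrow> 0 < w k" and unit: "(\<Sum>k\<le>l. (w k)\<^sup>2) = 1"
  shows "(\<Sum>k\<le>l. w k * ((if k = 0 then 0 else dqi_coupling q m (k - 1) * w (k - 1))
      + (if k = l then 0 else dqi_coupling q m k * w (k + 1)))) < (real q - 1) * (real m + 1)"
proof -
  define C where "C = (real q - 1) * (real m + 1)"
  define g where "g k = dqi_coupling q m k * w k * w (k + 1)" for k
  have C: "0 < C"
    using q by (simp add: C_def)
  have g: "2 * g k \<le> C * (((w k)\<^sup>2 + (w (k + 1))\<^sup>2) / 2)" if "k < l" for k
  proof -
    have "2 * g k = 2 * dqi_coupling q m k * (w k * w (k + 1))"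
      by (simp add: g_def)
    also have "\<dots> \<le> C * (w k * w (k + 1))"
      using dqi_coupling_le[of q k m] q l that pos[of k] pos[of "k + 1"]
      by (intro mult_right_mono) (auto simp: C_def)
    also have "\<dots> \<le> C * (((w k)\<^sup>2 + (w (k + 1))\<^sup>2) / 2)"
      using C sum_squares_bound[of "w k" "w (k + 1)"] by (intro mult_left_mono) auto
    finally show ?thesis .
  qed
  \<comment> \<open>By symmetry each product \<open>g k\<close> occurs twice, once in row
    \<open>k\<close> and once in row \<open>k + 1\<close>.\<close>
  have "(\<Sum>k\<le>l. w k * ((if k = 0 then 0 else dqi_coupling q m (k - 1) * w (k - 1))
      + (if k = l then 0 else dqi_coupling q m k * w (k + 1))))
    = (\<Sum>k\<le>l. (if k = 0 then 0 else g (k - 1)) + (if k = l then 0 else g k))"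
    by (intro sum.cong) (auto simp: g_def algebra_simps)
  also have "\<dots> = (\<Sum>k<l. g k) + (\<Sum>k\<le>l. if k = l then 0 else g k)"
    by (simp add: sum.distrib sum_pred_shift)
  also have "(\<Sum>k\<le>l. if k = l then 0 else g k) = (\<Sum>k<l. g k)"
    by (simp flip: lessThan_Suc_atMost)
  also have "(\<Sum>k<l. g k) + (\<Sum>k<l. g k) = (\<Sum>k<l. 2 * g k)"
    by (simp flip: sum_distrib_left)
  also have "\<dots> \<le> (\<Sum>k<l. C * (((w k)\<^sup>2 + (w (k + 1))\<^sup>2) / 2))"
    using g by (intro sum_mono) auto
  also have "\<dots> = C * (((\<Sum>k<l. (w k)\<^sup>2) + (\<Sum>k<l. (w (Suc k))\<^sup>2)) / 2)"
    by (simp add: sum.distrib flip: sum_distrib_left sum_divide_distrib)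
  \<comment> \<open>The two sums miss the positive end squares of \<open>w l\<close> and
    \<open>w 0\<close> respectively. For \<open>l = 0\<close> both are empty.\<close>
  also have "\<dots> < C * 1"
  proof (intro mult_strict_left_mono C)
    have "(\<Sum>k<l. (w k)\<^sup>2) + (w l)\<^sup>2 = 1"
      using unit by (simp flip: lessThan_Suc_atMost)
    moreover have "(w 0)\<^sup>2 + (\<Sum>k<l. (w (Suc k))\<^sup>2) = 1"
      using unit
      by (simp add: sum.lessThan_Suc_shift flip: lessThan_Suc_atMost del: sum.lessThan_Suc)
    moreover have "0 < (w 0)\<^sup>2" "0 < (w l)\<^sup>2"
      using pos[of 0] pos[of l] by auto
    ultimately show "((\<Sum>k<l. (w k)\<^sup>2) + (\<Sum>k<l. (w (Suc k))\<^sup>2)) / 2 < 1"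
      by (simp only: divide_less_eq_numeral1)
  qed
  finally show ?thesis
    by (simp add: C_def)
qed

text \<open>A multiple of the identity only shifts the eigenvalue, so the numerator of Jordan's
  tight form collapses to a difference of two numbers.\<close>

lemma scalar_prod_shifted_eigenvector:
  fixes A :: "real mat"
  assumes "A \<in> carrier_mat n n" and "eigenvector A w e" and "w \<bullet> w = 1"
  shows "w \<bullet> ((A - c \<cdot>\<^sub>m 1\<^sub>m n) *\<^sub>v w) = e - c"
proof -
  have w: "w \<in> carrier_vec n" and ev: "A *\<^sub>v w = e \<cdot>\<^sub>v w"
    using assms by (auto simp: eigenvector_def)
  have "(A - c \<cdot>\<^sub>m 1\<^sub>m n) *\<^sub>v w = A *\<^sub>v w - (c \<cdot>\<^sub>m 1\<^sub>m n) *\<^sub>v w"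
    using assms(1) w by (intro minus_mult_distrib_mat_vec) auto
  also have "(c \<cdot>\<^sub>m 1\<^sub>m n) *\<^sub>v w = c \<cdot>\<^sub>v w"
    using w by (intro eq_vecI) auto
  also have "A *\<^sub>v w - c \<cdot>\<^sub>v w = (e - c) \<cdot>\<^sub>v w"
    using w by (intro eq_vecI) (auto simp: ev algebra_simps)
  finally show ?thesis
    using w assms(3) by simp
qed

lemma eps_le_worst_failure: "k \<le> l \<Longrightarrow> eps k \<le> worst_failure l eps"
  by (auto simp: worst_failure_def)

lemma worst_failure_attained: "\<exists>k\<le>l. eps k = worst_failure l eps"
proof -
  have "worst_failure l eps \<in> eps ` {0..l}"
    unfolding worst_failure_def by (intro Max_in) auto
  then show ?thesis
    by auto
qed

text \<open>The upper bound on the worst failure rate is left to the individual lemmas: some need it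
  below \<open>1\<close>, others below \<open>1 / 2\<close>.\<close>

locale dqi_decoding =
  fixes q m l :: nat and d :: real and w :: "real vec" and eps :: "nat \<Rightarrow> real"
  assumes q: "2 \<le> q" and l: "l \<le> m"
    and leading: "leading_eigenvector (dqi_matrix q m l d) w"
    and eps_nonneg: "\<And>k. k \<le> l \<Longrightarrow> 0 \<le> eps k"
    and worst_pos: "0 < worst_failure l eps"
begin

abbreviation "lam \<equiv> lambda_max (dqi_matrix q m l d)"

section \<open>Consequences of the eigenvalue equation\<close>

lemma eigenvector: "eigenvector (dqi_matrix q m l d) w lam"
  and unit: "w \<bullet> w = 1"
  using leading by (auto simp: leading_eigenvector_def)

lemma dim: "w \<in> carrier_vec (l + 1)"
  using eigenvector by (simp add: eigenvector_def dqi_matrix_def)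

lemma w_pos: "k \<le> l \<Longrightarrow> 0 < w $ k"
  using leading dim by (auto simp: leading_eigenvector_def)

lemma sum_squares: "(\<Sum>k\<le>l. (w $ k)\<^sup>2) = 1"
  using unit_vec_sum_squares[OF dim unit] .

lemma eigen_equation:
  assumes "k \<le> l"
  shows "(lam - real k * d) * w $ k =
    (if k = 0 then 0 else dqi_coupling q m (k - 1) * w $ (k - 1))
    + (if k = l then 0 else dqi_coupling q m k * w $ (k + 1))"
proof -
  have "(dqi_matrix q m l d *\<^sub>v w) $ k = lam * w $ k"
    using eigenvector dim assms by (simp add: eigenvector_def)
  then show ?thesis
    unfolding dqi_matrix_mult_vec[OF dim assms] by (simp add: algebra_simps)
qed

text \<open>The couplings are nonnegative and \<open>w\<close> is positive, so the eigenvalue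
  equation forces the sign, whatever the sign of \<open>d\<close>. The case \<open>k = 0\<close>
  gives nonnegativity of \<open>lam\<close>.\<close>

lemma lam_minus_offset_nonneg:
  assumes "k \<le> l"
  shows "0 \<le> lam - real k * d"
proof -
  have "0 \<le> (lam - real k * d) * w $ k"
    unfolding eigen_equation[OF assms]
    using assms l q by (auto intro!: add_nonneg_nonneg mult_nonneg_nonneg dqi_coupling_nonneg
        less_imp_le[OF w_pos])
  then show ?thesis
    using w_pos[OF assms] by (simp add: zero_le_mult_iff)
qed

section \<open>Weighted failure rates\<close>

lemma weighted_failure_le: "weighted_failure l w eps \<le> worst_failure l eps"
proof -
  have "weighted_failure l w eps \<le> (\<Sum>k\<le>l. worst_failure l eps * (w $ k)\<^sup>2)"
    unfolding weighted_failure_def atLeast0AtMost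
    by (intro sum_mono mult_right_mono eps_le_worst_failure) auto
  also have "\<dots> = worst_failure l eps"
    using sum_squares by (simp flip: sum_distrib_left)
  finally show ?thesis .
qed

text \<open>The worst layer carries positive weight because no entry of \<open>w\<close> vanishes.
  This keeps the denominator strictly below \<open>1\<close>.\<close>

lemma weighted_failure_pos: "0 < weighted_failure l w eps"
proof -
  obtain k where "k \<le> l" "eps k = worst_failure l eps"
    using worst_failure_attained by blast
  then have "0 < eps k * (w $ k)\<^sup>2"
    using worst_pos w_pos[of k] by simp
  with \<open>k \<le> l\<close> show ?thesis
    unfolding weighted_failure_def using eps_nonneg by (intro sum_pos2[of _ k]) auto
qed

lemma weighted_failure_moment_nonneg: "0 \<le> weighted_failure_moment l w eps"
  unfolding weighted_failure_moment_def using eps_nonneg by (intro sum_nonneg) auto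

lemma sum_success: "(\<Sum>k = 0..l. (w $ k)\<^sup>2 * (1 - eps k)) = 1 - weighted_failure l w eps"
  using sum_squares
  by (simp add: weighted_failure_def algebra_simps sum_subtractf atLeast0AtMost)

section \<open>Comparison of the bounds\<close>

lemma jordan_tight_eq:
  "jordan_tight q m l d w eps = (lam - jordan_penalty q m l eps) / (1 - weighted_failure l w eps)"
proof -
  have "dqi_matrix q m l d \<in> carrier_mat (l + 1) (l + 1)"
    by (simp add: dqi_matrix_def)
  then show ?thesis
    unfolding jordan_tight_def sum_success
    by (simp only: scalar_prod_shifted_eigenvector[OF _ eigenvector unit])
qed

lemma master_bound_eq:
  "master_bound q m l d w eps =
     (lam - rayleigh_penalty q m l d w eps + 2 * d * weighted_failure_moment l w eps)
     / (1 - weighted_failure l w eps)"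
  by (simp add: master_bound_def rayleigh_penalty_def algebra_simps)

lemma rayleigh_penalty_less:
  "rayleigh_penalty q m l d w eps - 2 * d * weighted_failure_moment l w eps
     < jordan_penalty q m l eps"
proof -
  \<comment> \<open>Absorbing the offset moment layer by layer turns \<open>lam\<close> into
    \<open>lam - k * d\<close>, the factor in the eigenvalue equation.\<close>
  have "rayleigh_penalty q m l d w eps - 2 * d * weighted_failure_moment l w eps
      = 2 * (\<Sum>k\<le>l. eps k * ((lam - real k * d) * (w $ k)\<^sup>2))"
    by (simp add: rayleigh_penalty_def weighted_failure_def weighted_failure_moment_def
        atLeast0AtMost algebra_simps sum_subtractf sum_distrib_left)
  also have "(\<Sum>k\<le>l. eps k * ((lam - real k * d) * (w $ k)\<^sup>2))
      \<le> (\<Sum>k\<le>l. worst_failure l eps * ((lam - real k * d) * (w $ k)\<^sup>2))"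
    using lam_minus_offset_nonneg
    by (intro sum_mono mult_right_mono eps_le_worst_failure mult_nonneg_nonneg) auto
  also have "\<dots> = worst_failure l eps * (\<Sum>k\<le>l. w $ k * ((lam - real k * d) * w $ k))"
    by (simp add: sum_distrib_left power2_eq_square mult_ac)
  also have "\<dots> < worst_failure l eps * ((real q - 1) * (real m + 1))"
    using coupling_form_less[OF q l w_pos sum_squares] worst_pos
    by (intro mult_strict_left_mono) (simp_all add: eigen_equation)
  finally show ?thesis
    by (simp add: jordan_penalty_def algebra_simps)
qed

lemma jordan_tight_less_master_bound:
  assumes "worst_failure l eps < 1"
  shows "jordan_tight q m l d w eps < master_bound q m l d w eps"
  unfolding jordan_tight_eq master_bound_eq
  using rayleigh_penalty_less weighted_failure_le assms
  by (intro divide_strict_right_mono) auto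

text \<open>Division by a number strictly between \<open>0\<close> and \<open>1\<close> does not
  decrease a real exactly when that real is nonnegative.\<close>

lemma jordan_relaxed_le_jordan_tight_iff:
  assumes "worst_failure l eps < 1"
  shows "jordan_relaxed q m l d eps \<le> jordan_tight q m l d w eps
    \<longleftrightarrow> jordan_penalty q m l eps \<le> lam"
proof -
  define e where "e = weighted_failure l w eps"
  have e: "0 < e" "e < 1"
    using weighted_failure_pos weighted_failure_le assms by (auto simp: e_def)
  have "x \<le> x / (1 - e) \<longleftrightarrow> 0 \<le> x" for x :: real
    using e by (simp add: pos_le_divide_eq algebra_simps zero_le_mult_iff)
  from this[of "lam - jordan_penalty q m l eps"] show ?thesis
    by (simp add: jordan_relaxed_def jordan_tight_eq e_def)
qed

lemma master_bound_nonneg: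
  assumes "worst_failure l eps < 1 / 2" and "0 \<le> d"
  shows "0 \<le> master_bound q m l d w eps"
  unfolding master_bound_def
  \<comment> \<open>The bound \<open>1 / 2\<close> makes the factor
    \<open>1 - 2 * weighted_failure l w eps\<close> positive.\<close>
  using assms weighted_failure_le weighted_failure_moment_nonneg lam_minus_offset_nonneg[of 0]
  by (intro divide_nonneg_nonneg add_nonneg_nonneg mult_nonneg_nonneg) auto

text \<open>While Jordan's chain holds, the comparison passes through the tight form; where it
  breaks, signs alone decide.\<close>

lemma jordan_relaxed_less_master_bound:
  assumes "worst_failure l eps < 1 / 2" and "0 \<le> d"
  shows "jordan_relaxed q m l d eps < master_bound q m l d w eps"
proof (cases "jordan_penalty q m l eps \<le> lam")
  case True
  then show ?thesis
    using jordan_relaxed_le_jordan_tight_iff jordan_tight_less_master_bound assms by force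
next
  case False
  then show ?thesis
    using master_bound_nonneg[OF assms] by (simp add: jordan_relaxed_def)
qed

end

theorem theorem3p2:
  fixes q m l :: nat and d :: real and w :: "real vec" and eps :: "nat \<Rightarrow> real"
  assumes "primepow q" and "0 < m" and "l \<le> m"
    and "leading_eigenvector (dqi_matrix q m l d) w"
    and "\<And>k. k \<le> l \<Longrightarrow> 0 \<le> eps k \<and> eps k \<le> 1"
    and "0 < worst_failure l eps" and "worst_failure l eps < 1 / 2"
  shows
    "jordan_tight q m l d w eps \<le> master_bound q m l d w eps \<and>
     (jordan_relaxed q m l d eps \<le> jordan_tight q m l d w eps
        \<longleftrightarrow> jordan_penalty q m l eps \<le> lambda_max (dqi_matrix q m l d)) \<and>
     (0 \<le> d \<longrightarrow> jordan_relaxed q m l d eps \<le> master_bound q m l d w eps) \<and>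
     (\<not> ((\<exists>c. \<forall>k\<le>l. eps k = c) \<and> real l / real m = 1 / 2) \<longrightarrow>
        jordan_tight q m l d w eps < master_bound q m l d w eps \<and>
        (0 \<le> d \<longrightarrow> jordan_relaxed q m l d eps < master_bound q m l d w eps)) \<and>
     master_bound q m l d w eps =
       (lambda_max (dqi_matrix q m l d) - rayleigh_penalty q m l d w eps
          + 2 * d * weighted_failure_moment l w eps) / (1 - weighted_failure l w eps) \<and>
     jordan_tight q m l d w eps =
       (lambda_max (dqi_matrix q m l d) - jordan_penalty q m l eps)
         / (1 - weighted_failure l w eps) \<and>
     master_bound q m l d w eps - jordan_relaxed q m l d eps =
       structural_gain q m l d w eps + denominator_gain q m l d w eps \<and>
     master_bound q m l d w eps - jordan_tight q m l d w eps =
       structural_gain q m l d w eps \<and>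
     weighted_failure l w eps \<le> worst_failure l eps \<and>
     jordan_penalty q m l eps - rayleigh_penalty q m l d w eps =
       2 * (worst_failure l eps - weighted_failure l w eps) * ((real q - 1) * (real m + 1))
       + 2 * weighted_failure l w eps
           * ((real q - 1) * (real m + 1) - lambda_max (dqi_matrix q m l d))"
proof -
  have "1 < q"
    using assms(1) by (rule primepow_gt_Suc_0[unfolded One_nat_def[symmetric]])
  then interpret dqi_decoding q m l d w eps
    using assms by unfold_locales auto
  have worst: "worst_failure l eps < 1"
    using assms by simp
  have tight: "master_bound q m l d w eps - jordan_tight q m l d w eps =
      structural_gain q m l d w eps"
    by (simp add: master_bound_eq jordan_tight_eq structural_gain_def flip: diff_divide_distrib)
  \<comment> \<open>The denominator gain is exactly the tight form minus the relaxed form, so the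
    differences telescope.\<close>
  then have relaxed: "master_bound q m l d w eps - jordan_relaxed q m l d eps =
      structural_gain q m l d w eps + denominator_gain q m l d w eps"
    by (simp add: jordan_tight_eq jordan_relaxed_def denominator_gain_def)
  \<comment> \<open>The mixed term \<open>2 * weighted_failure l w eps * ((q - 1) * (m + 1))\<close>
    is inserted, which separates the change of failure rate from the change of scale.\<close>
  have penalty: "jordan_penalty q m l eps - rayleigh_penalty q m l d w eps =
      2 * (worst_failure l eps - weighted_failure l w eps) * ((real q - 1) * (real m + 1))
      + 2 * weighted_failure l w eps * ((real q - 1) * (real m + 1) - lam)"
    by (simp add: jordan_penalty_def rayleigh_penalty_def algebra_simps)
  show ?thesis
    using jordan_tight_less_master_bound[OF worst] jordan_relaxed_le_jordan_tight_iff[OF worst]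
      jordan_relaxed_less_master_bound[OF assms(7)] tight relaxed penalty
      weighted_failure_le master_bound_eq jordan_tight_eq
    by (intro conjI impI) (simp_all add: less_imp_le)
qed

end
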